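(* Let $G=(N,(n_i)_{i\in[N]})$ be a multi-unit game with $N\ge 3$ players and with a dominant player, and let $n=\sum_{i=1}^N n_i$. Suppose there exist positive integers $b_1,\dots,b_{N-1}$ such that $\sum_{i=1}^{N-1}b_i=n_N$ and $\frac{n_i}{b_i}=\frac{n-n_N}{n_N}$ for all $i\in\{1,\dots,N-1\}$. Then $G$ possesses a mixed Nash equilibrium.
   Context: Multi-unit game $G=(N,(n_i)_{i\in[N]})$: customers are uniformly distributed on $[0,1]$; $[N]=\{1,\dots,N\}$ is the set of players; $n_1\le\dots\le n_N$ are positive integers. The pure strategy set of player $i$ is $S_i=\{(s_i^1,\dots,s_i^{n_i})\in[0,1]^{n_i}: s_i^1<\dots<s_i^{n_i}\}$; a pure strategy is identified with the set of its coordinates (player $i$'s facilities). For a pure profile $\mathbf s=(s_1,\dots,s_N)$ let $\mathcal L(\mathbf s)=\bigcup_i s_i$, $d(t,A)=\min_{f\in A}|t-f|$, and $r_t(\mathbf s)=\{i\in[N]: d(t,s_i)\le d(t,\mathcal L(\mathbf s))\}$. The payoff is $u_i(\mathbf s)=\int_0^1\frac{\mathbf 1[i\in r_t(\mathbf s)]}{|r_t(\mathbf s)|}\,dt$. $\Delta(S_i)$ is the set of Borel probability measures on $S_i$ (mixed strategies), and payoffs extend to mixed profiles $\mathbf x\in\prod_i\Delta(S_i)$ by $u_i(\mathbf x)=\mathbb E_{\mathbf s\sim\mathbf x}u_i(\mathbf s)$, the players' strategies being drawn independently. A mixed profile $\mathbf x\in\prod_i\Delta(S_i)$ is a (mixed)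 Nash equilibrium if $u_i(x_i',\mathbf x_{-i})\le u_i(\mathbf x)$ for every $i\in[N]$ and $x_i'\in\Delta(S_i)$. Player $N$ is called a dominant player if $\sum_{i=1}^{N-1}n_i<n_N$; the game has a dominant player if player $N$ is dominant. *)

theory Defs
  imports "HOL-Probability.Probability"
begin

text \<open>A game is given by the number \<open>N\<close> of players \<open>1, \<dots>, N\<close> and the numbers \<open>n i\<close> of
  facilities of the players; values of \<open>n\<close> outside \<open>{1..N}\<close> are irrelevant.\<close>

definition multi_unit_game :: "nat \<Rightarrow> (nat \<Rightarrow> nat) \<Rightarrow> bool" where
  "multi_unit_game N n \<longleftrightarrow> 1 \<le> N \<and> (\<forall>i\<in>{1..N}. 0 < n i) \<and> mono_on {1..N} n"

definition has_dominant_player :: "nat \<Rightarrow> (nat \<Rightarrow> nat) \<Rightarrow> bool" where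
  "has_dominant_player N n \<longleftrightarrow> (\<Sum>i=1..N - 1. n i) < n N"

text \<open>Tuples in \<open>[0,1]\<^sup>k\<close> are functions on \<open>{1..k}\<close> that are \<open>undefined\<close> elsewhere.\<close>

definition pure_strategies :: "nat \<Rightarrow> (nat \<Rightarrow> real) set" where
  "pure_strategies k = {s \<in> {1..k} \<rightarrow>\<^sub>E {0..1}. strict_mono_on {1..k} s}"

text \<open>The finite product of the Borel spaces of the reals is the Borel space of \<open>\<real>\<^sup>k\<close>, so its
  restriction carries the Borel sets of the subspace of pure strategies.\<close>

definition strategy_space :: "nat \<Rightarrow> (nat \<Rightarrow> real) measure" where
  "strategy_space k = restrict_space (\<Pi>\<^sub>M j\<in>{1..k}. borel) (pure_strategies k)"

definition mixed_strategies :: "nat \<Rightarrow> (nat \<Rightarrow> real) measure set" where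
  "mixed_strategies k = {\<mu>. prob_space \<mu> \<and> sets \<mu> = sets (strategy_space k)}"

definition facilities :: "(nat \<Rightarrow> nat) \<Rightarrow> (nat \<Rightarrow> nat \<Rightarrow> real) \<Rightarrow> nat \<Rightarrow> real set" where
  "facilities n s i = s i ` {1..n i}"

definition all_facilities :: "nat \<Rightarrow> (nat \<Rightarrow> nat) \<Rightarrow> (nat \<Rightarrow> nat \<Rightarrow> real) \<Rightarrow> real set" where
  "all_facilities N n s = (\<Union>i\<in>{1..N}. facilities n s i)"

text \<open>Only applied to finite nonempty sets.\<close>

definition set_distance :: "real \<Rightarrow> real set \<Rightarrow> real" where
  "set_distance t A = Min ((\<lambda>f. \<bar>t - f\<bar>) ` A)"

definition nearest_players :: "nat \<Rightarrow> (nat \<Rightarrow> nat) \<Rightarrow> (nat \<Rightarrow> nat \<Rightarrow> real) \<Rightarrow> real \<Rightarrow> nat set" where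
  "nearest_players N n s t =
     {i \<in> {1..N}. set_distance t (facilities n s i) \<le> set_distance t (all_facilities N n s)}"

definition pure_payoff :: "nat \<Rightarrow> (nat \<Rightarrow> nat) \<Rightarrow> nat \<Rightarrow> (nat \<Rightarrow> nat \<Rightarrow> real) \<Rightarrow> real" where
  "pure_payoff N n i s =
     (LINT t:{0..1}|lborel. of_bool (i \<in> nearest_players N n s t) / real (card (nearest_players N n s t)))"

text \<open>Independent draws of the players: the profile is distributed according to the product measure.\<close>

definition payoff :: "nat \<Rightarrow> (nat \<Rightarrow> nat) \<Rightarrow> nat \<Rightarrow> (nat \<Rightarrow> (nat \<Rightarrow> real) measure) \<Rightarrow> real" where
  "payoff N n i x = (LINT s|(\<Pi>\<^sub>M j\<in>{1..N}. x j). pure_payoff N n i s)"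

definition mixed_Nash_equilibrium ::
  "nat \<Rightarrow> (nat \<Rightarrow> nat) \<Rightarrow> (nat \<Rightarrow> (nat \<Rightarrow> real) measure) \<Rightarrow> bool" where
  "mixed_Nash_equilibrium N n x \<longleftrightarrow>
     (\<forall>i\<in>{1..N}. x i \<in> mixed_strategies (n i)) \<and>
     (\<forall>i\<in>{1..N}. \<forall>x'\<in>mixed_strategies (n i). payoff N n i (x(i := x')) \<le> payoff N n i x)"

end

theory Submission
  imports Defs
begin

text \<open>
  Write \<open>K = n\<^sub>N\<close>, \<open>m = n\<^sub>1 + \<dots> + n\<^sub>N\<^sub>-\<^sub>1\<close> and \<open>p = m / K < 1\<close>. In equilibrium the dominant player
  occupies the grid points \<open>(2j + 1) / (2K)\<close>, \<open>j < K\<close>. The grid is split into blocks of sizes \<open>b\<^sub>i\<close>, and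
  player \<open>i < N\<close> occupies a uniformly random \<open>n\<^sub>i\<close>-subset of block \<open>i\<close>, so that every grid point is
  taken by exactly one weak player with probability \<open>n\<^sub>i / b\<^sub>i = p\<close> and by none otherwise.

  The estimate behind both best-response conditions is that a single facility earns at most
  \<open>1 / (2K)\<close> against a rival who occupies the whole grid. It bounds the payoff of a deviating
  weak player by \<open>n\<^sub>i / (2K)\<close>. If the dominant player deviates to some set of \<open>K\<close> facilities, then on
  the cell of an occupied grid point it earns no more than against the whole grid, where it would
  earn at most \<open>1/2\<close> in total; hence the weak players lose at most half of the mass \<open>p\<close> of the
  occupied cells, and the dominant player earns at most \<open>1 - p / 2\<close>. On the equilibrium path both
  bounds are attained.
\<close>

section \<open>A single facility against the grid\<close>

text \<open>The midpoint of the \<open>j\<close>-th of \<open>K\<close> equal subintervals of [0,1],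
  counted from 0.\<close>

definition grid_point :: "nat \<Rightarrow> nat \<Rightarrow> real" where
  "grid_point K j = (2 * real j + 1) / (2 * real K)"

definition grid :: "nat \<Rightarrow> real set" where
  "grid K = grid_point K ` {..<K}"

text \<open>The customers for whom \<open>grid_point K j\<close> is the unique nearest grid point.
  Open ends keep distinct cells disjoint; at a common endpoint two grid points tie.\<close>

definition cell :: "nat \<Rightarrow> nat \<Rightarrow> real set" where
  "cell K j = {real j / real K <..< (real j + 1) / real K}"

text \<open>The share of the customer \<open>t\<close> won by a facility at \<open>u\<close> against a rival occupying the whole grid.\<close>

definition cover :: "nat \<Rightarrow> real \<Rightarrow> real \<Rightarrow> real" where
  "cover K u t =
     (if \<bar>t - u\<bar> < set_distance t (grid K) then 1
      else if \<bar>t - u\<bar> = set_distance t (grid K) then 1 / 2 else 0)"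

text \<open>The integrand of \<open>pure_payoff\<close>, named because payoffs are bounded pointwise
  in the customer \<open>t\<close>.\<close>

definition share :: "nat \<Rightarrow> (nat \<Rightarrow> nat) \<Rightarrow> nat \<Rightarrow> (nat \<Rightarrow> nat \<Rightarrow> real) \<Rightarrow> real \<Rightarrow> real" where
  "share N n i s t =
     of_bool (i \<in> nearest_players N n s t) / real (card (nearest_players N n s t))"

section \<open>Distances to the grid and the cells of its points\<close>

lemma set_distance_le_iff:
  "finite A \<Longrightarrow> A \<noteq> {} \<Longrightarrow> set_distance t A \<le> d \<longleftrightarrow> (\<exists>f\<in>A. \<bar>t - f\<bar> \<le> d)"
  by (simp add: set_distance_def Min_le_iff)

lemma le_set_distance_iff:
  "finite A \<Longrightarrow> A \<noteq> {} \<Longrightarrow> d \<le> set_distance t A \<longleftrightarrow> (\<forall>f\<in>A. d \<le> \<bar>t - f\<bar>)"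
  by (simp add: set_distance_def)

lemma finite_grid [simp]: "finite (grid K)"
  by (simp add: grid_def)

lemma grid_nonempty: "0 < K \<Longrightarrow> grid K \<noteq> {}"
  by (auto simp: grid_def)

lemma cell_iff: "0 < K \<Longrightarrow> t \<in> cell K j \<longleftrightarrow> \<bar>t - grid_point K j\<bar> < 1 / (2 * real K)"
  by (auto simp: cell_def grid_point_def abs_less_iff field_simps)

lemma cell_subset:
  assumes "j < K"
  shows "cell K j \<subseteq> {0..1}"
proof -
  have "0 \<le> real j / real K" by simp
  moreover have "(real j + 1) / real K \<le> 1" using assms by simp
  ultimately show ?thesis
    unfolding cell_def by (intro subsetI) (unfold greaterThanLessThan_iff atLeastAtMost_iff, linarith)
qed

lemma cell_disjoint:
  assumes "0 < K" "t \<in> cell K i" "t \<in> cell K j"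
  shows "i = j"
proof -
  have "real i < real j + 1" "real j < real i + 1"
    using assms by (auto simp: cell_def field_simps)
  then show ?thesis by linarith
qed

text \<open>A cell is the open ball of radius \<open>1 / (2 * real K)\<close> around its grid point.
  A grid point at least as close would therefore have \<open>t\<close> in its own cell too, and
  cells are disjoint.\<close>

lemma nearest_grid_point_unique:
  assumes "t \<in> cell K j" "\<bar>t - grid_point K i\<bar> \<le> \<bar>t - grid_point K j\<bar>" "0 < K"
  shows "i = j"
  using assms cell_disjoint[of K t i j] by (simp add: cell_iff)

lemma set_distance_grid_in_cell:
  assumes "t \<in> cell K j" "j < K"
  shows "set_distance t (grid K) = \<bar>t - grid_point K j\<bar>"
proof (rule antisym)
  show "set_distance t (grid K) \<le> \<bar>t - grid_point K j\<bar>"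
    using assms by (subst set_distance_le_iff) (auto simp: grid_def)
  show "\<bar>t - grid_point K j\<bar> \<le> set_distance t (grid K)"
    using assms nearest_grid_point_unique[OF assms(1)]
    by (subst le_set_distance_iff) (auto simp: grid_def, metis less_imp_le linorder_not_less)
qed

lemma set_distance_grid_le:
  assumes "t \<in> {0..1}" "0 < K"
  shows "set_distance t (grid K) \<le> 1 / (2 * real K)"
proof -
  \<comment> \<open>The index of a closed cell containing \<open>t\<close>. At \<open>t = 1\<close>
    the floor would give \<open>K\<close>, one beyond the last grid point.\<close>
  define j where "j = (if t = 1 then K - 1 else nat \<lfloor>t * K\<rfloor>)"
  have "j < K \<and> real j \<le> t * K \<and> t * K \<le> real j + 1"
  proof (cases "t = 1")
    case False
    then have "t * K < K" using assms by simp
    then have "nat \<lfloor>t * K\<rfloor> < K" using assms by (simp add: nat_less_iff floor_less_iff)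
    moreover have "real (nat \<lfloor>t * K\<rfloor>) = \<lfloor>t * K\<rfloor>" using assms by simp
    ultimately show ?thesis unfolding j_def using False by simp
  qed (use assms in \<open>auto simp: j_def of_nat_diff\<close>)
  then have "j < K" "\<bar>t - grid_point K j\<bar> \<le> 1 / (2 * real K)"
    using assms by (auto simp: grid_point_def abs_le_iff field_simps)
  then show ?thesis
    using assms by (subst set_distance_le_iff) (auto simp: grid_def)
qed

section \<open>Measurability and integral of the cover of a single facility\<close>

lemma cover_nonneg: "0 \<le> cover K u t"
  by (simp add: cover_def)

lemma cover_le_1: "cover K u t \<le> 1"
  by (simp add: cover_def)

lemma borel_measurable_set_distance_grid [measurable]:
  "(\<lambda>t. set_distance t (grid K)) \<in> borel_measurable borel"
proof -
  have "(\<lambda>t. Min ((\<lambda>f. \<bar>t - f\<bar>) ` grid K)) \<in> borel_measurable borel"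
    by (rule borel_measurable_Min) auto
  then show ?thesis by (simp add: set_distance_def)
qed

lemma borel_measurable_cover [measurable]:
  assumes [measurable]: "f \<in> borel_measurable M" "g \<in> borel_measurable M"
  shows "(\<lambda>x. cover K (f x) (g x)) \<in> borel_measurable M"
  unfolding cover_def by measurable

lemma set_integrable_bounded:
  fixes f :: "real \<Rightarrow> real"
  assumes "f \<in> borel_measurable borel" "\<And>t. \<bar>f t\<bar> \<le> B" "A \<in> sets borel" "A \<subseteq> {a..b}"
  shows "set_integrable lborel A f"
proof (rule set_integrable_bound)
  show "set_integrable lborel A (\<lambda>_. B)"
    using assms(3) set_integrable_subset[of lborel "{a..b}" "\<lambda>_. B" A] assms(4)
    by (simp add: borel_integrable_atLeastAtMost' continuous_on_const)
  show "set_borel_measurable lborel A f"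
    using assms(1,3) by (simp add: set_borel_measurable_def)
  show "AE x in lborel. x \<in> A \<longrightarrow> norm (f x) \<le> norm B"
    using order_trans[OF assms(2) abs_ge_self] by (intro AE_I2) simp
qed

lemma
  fixes f :: "'i \<Rightarrow> 'a \<Rightarrow> real"
  assumes "\<And>i. i \<in> I \<Longrightarrow> set_integrable M A (f i)"
  shows set_integrable_sum: "set_integrable M A (\<lambda>x. \<Sum>i\<in>I. f i x)"
    and set_lebesgue_integral_sum: "(LINT x:A|M. \<Sum>i\<in>I. f i x) = (\<Sum>i\<in>I. LINT x:A|M. f i x)"
  using assms unfolding set_integrable_def set_lebesgue_integral_def scaleR_sum_right
  by (auto intro!: Bochner_Integration.integrable_sum Bochner_Integration.integral_sum)

lemma set_integrable_cover:
  "A \<in> sets borel \<Longrightarrow> A \<subseteq> {0..1} \<Longrightarrow> set_integrable lborel A (cover K u)"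
  by (rule set_integrable_bounded[where B = 1]) (use cover_nonneg cover_le_1 in auto)

lemma borel_cell [measurable]: "cell K j \<in> sets borel"
  by (simp add: cell_def)

lemma integrable_cell: "0 < K \<Longrightarrow> integrable lborel (indicator (cell K j) :: real \<Rightarrow> real)"
  by (intro integrable_real_indicator) (auto simp: cell_def divide_right_mono)

lemma measure_cell: "0 < K \<Longrightarrow> measure lborel (cell K j) = 1 / real K"
  by (simp add: cell_def diff_divide_distrib[symmetric] divide_right_mono)

text \<open>On a grid point the facility at best ties, earning 1/2 on a window of length
  \<open>1 / K\<close>. Strictly between two neighbouring grid points it wins only up to the
  midpoints towards them, which is half of a gap of length \<open>1 / K\<close>.\<close>

lemma integral_cover_le:
  assumes u: "u \<in> {0..1}" and K: "0 < K"
  shows "(LINT t:{0..1}|lborel. cover K u t) \<le> 1 / (2 * real K)"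
proof -
  \<comment> \<open>Both cases bound the cover by \<open>c\<close> times the indicator of an
    interval: \<open>c = 1/2\<close> with length \<open>1 / K\<close> on the grid,
    \<open>c = 1\<close> with length \<open>1 / (2 * K)\<close> off it.\<close>
  have *: "(LINT t:{0..1}|lborel. cover K u t) \<le> c * (b - a)"
    if "\<And>t. t \<in> {0..1} \<Longrightarrow> cover K u t \<le> c * indicator {a..b} t" "a \<le> b" "0 \<le> c" for a b c
  proof -
    have "(LINT t:{0..1}|lborel. cover K u t) \<le> (LINT t|lborel. c * indicator {a..b} t)"
      unfolding set_lebesgue_integral_def
    proof (rule integral_mono)
      show "integrable lborel (\<lambda>t. indicator {0..1} t *\<^sub>R cover K u t)"
        using set_integrable_cover[of "{0..1}" K u] by (simp add: set_integrable_def)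
      show "integrable lborel (\<lambda>t. c * indicator {a..b} t)"
        using that(2) by (intro integrable_mult_right integrable_real_indicator) auto
      show "indicator {0..1} t *\<^sub>R cover K u t \<le> c * indicator {a..b} t" for t
        using that(1)[of t] that(3) by (auto simp: indicator_def)
    qed
    also have "\<dots> = c * (b - a)" using that(2) by simp
    finally show ?thesis .
  qed
  show ?thesis
  proof (cases "u \<in> grid K")
    case True
    then have near: "set_distance t (grid K) \<le> \<bar>t - u\<bar>" for t
      by (subst set_distance_le_iff) auto
    have "cover K u t \<le> (1/2) * indicator {u - 1 / (2 * real K)..u + 1 / (2 * real K)} t"
      if "t \<in> {0..1}" for t
    proof (cases "\<bar>t - u\<bar> = set_distance t (grid K)")
      case True
      then have "\<bar>t - u\<bar> \<le> 1 / (2 * real K)" using set_distance_grid_le[OF that K] by simp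
      then have "t \<in> {u - 1 / (2 * real K)..u + 1 / (2 * real K)}"
        unfolding atLeastAtMost_iff abs_le_iff by linarith
      then show ?thesis using True by (simp add: cover_def)
    next
      case False
      then have "cover K u t = 0" using near[of t] by (simp add: cover_def)
      then show ?thesis by simp
    qed
    from *[OF this] show ?thesis using K by (simp add: field_simps)
  next
    case False
    \<comment> \<open>The grid is extended by the reflected points \<open>g (-1)\<close> and \<open>g K\<close>, so that \<open>u\<close> always lies in a gap;
      the midpoints towards them do not lie
      strictly inside \<open>[0,1]\<close>.\<close>
    define j where "j = \<lfloor>u * K - 1 / 2\<rfloor>"
    define g where "g i = (2 * real_of_int i + 1) / (2 * real K)" for i
    have g: "g i \<in> grid K" if "0 \<le> i" "i < int K" for i
      using that by (auto simp: g_def grid_def grid_point_def intro!: image_eqI[of _ _ "nat i"])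
    have j: "real_of_int j \<le> u * K - 1 / 2" "u * K - 1 / 2 < real_of_int j + 1"
      unfolding j_def by linarith+
    have gj: "g j \<le> u" "u < g (j + 1)"
      using j K by (auto simp: g_def field_simps)
    have "0 \<le> u * K" "u * K \<le> K" using u K by (auto simp: mult_left_le_one_le)
    then have jr: "- 1 \<le> j" "j \<le> int K - 1" using j by linarith+
    have dist: "\<bar>t - u\<bar> \<le> \<bar>t - f\<bar>" if "cover K u t \<noteq> 0" "f \<in> grid K" for t f
    proof -
      have "\<bar>t - u\<bar> \<le> set_distance t (grid K)"
        using that(1) by (auto simp: cover_def split: if_splits)
      then show ?thesis using that(2) by (subst (asm) le_set_distance_iff) auto
    qed
    have "cover K u t \<le> 1 * indicator {(g j + u) / 2..(u + g (j + 1)) / 2} t"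
      if t: "t \<in> {0..1}" for t
    proof (cases "cover K u t = 0")
      case nz: False
      have "(g j + u) / 2 \<le> t"
      proof (cases "j = - 1")
        case True
        \<comment> \<open>Here \<open>u\<close> lies left of the first grid point
          \<open>g 0\<close>, and \<open>g (-1) = - g 0\<close>. The lower midpoint is thus at most
          0.\<close>
        have "g j + u \<le> 0" using gj True by (simp add: g_def)
        then show ?thesis using t by simp
      next
        case jn: False
        then have "g j \<in> grid K" using g jr by simp
        then have "\<bar>t - u\<bar> \<le> \<bar>t - g j\<bar>" "g j \<noteq> u" using dist[OF nz] False by auto
        then show ?thesis using gj by (auto simp: abs_if split: if_splits)
      qed
      moreover have "t \<le> (u + g (j + 1)) / 2"
      proof (cases "j = int K - 1")
        case True
        \<comment> \<open>The last grid point and its reflection are symmetric about 1. As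
          \<open>u\<close> is at least \<open>g j\<close>, the upper midpoint is at least 1.\<close>
        have "g j + g (j + 1) = 2" using K by (simp add: g_def True field_simps)
        then show ?thesis using t gj by simp
      next
        case jn: False
        then have "g (j + 1) \<in> grid K" using g jr by simp
        then have "\<bar>t - u\<bar> \<le> \<bar>t - g (j + 1)\<bar>" using dist[OF nz] by auto
        then show ?thesis using gj by (auto simp: abs_if split: if_splits)
      qed
      ultimately show ?thesis using cover_le_1[of K u t] by simp
    qed simp
    \<comment> \<open>The position of \<open>u\<close> cancels from the length of the interval
      between the two midpoints.\<close>
    from *[OF this] have "(LINT t:{0..1}|lborel. cover K u t) \<le> (g (j + 1) - g j) / 2"
      using gj by (simp add: field_simps)
    also have "\<dots> = 1 / (2 * real K)" using K by (simp add: g_def field_simps)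
    finally show ?thesis .
  qed
qed

section \<open>Pure payoffs\<close>

lemma finite_facilities [simp]: "finite (facilities n s i)"
  by (simp add: facilities_def)

lemma finite_all_facilities [simp]: "finite (all_facilities N n s)"
  by (simp add: all_facilities_def)

lemma finite_nearest_players [simp]: "finite (nearest_players N n s t)"
  by (simp add: nearest_players_def)

lemma facilities_nonempty: "0 < n i \<Longrightarrow> facilities n s i \<noteq> {}"
  by (auto simp: facilities_def)

text \<open>Trades the minima for quantifiers over facilities. Player \<open>i\<close> owning a
  facility makes both sets under the minima nonempty.\<close>

lemma nearest_players_iff:
  assumes "i \<in> {1..N}" "0 < n i"
  shows "i \<in> nearest_players N n s t \<longleftrightarrow>
    (\<exists>f\<in>facilities n s i. \<forall>k\<in>{1..N}. \<forall>f'\<in>facilities n s k. \<bar>t - f\<bar> \<le> \<bar>t - f'\<bar>)"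
proof -
  have "all_facilities N n s \<noteq> {}"
    using assms facilities_nonempty[of n i s] by (auto simp: all_facilities_def)
  then have "i \<in> nearest_players N n s t \<longleftrightarrow>
      (\<exists>f\<in>facilities n s i. \<forall>f'\<in>all_facilities N n s. \<bar>t - f\<bar> \<le> \<bar>t - f'\<bar>)"
    using assms facilities_nonempty[of n i s]
      le_set_distance_iff[of "all_facilities N n s" "\<bar>t - f\<bar>" t for f]
      set_distance_le_iff[of "facilities n s i" t "set_distance t (all_facilities N n s)"]
    by (simp only: nearest_players_def mem_Collect_eq finite_facilities finite_all_facilities
        simp_thms)
  then show ?thesis by (auto simp: all_facilities_def)
qed

lemma nearest_players_nonempty:
  assumes "\<forall>i\<in>{1..N}. 0 < n i" "1 \<le> N"
  shows "nearest_players N n s t \<noteq> {}"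
proof -
  let ?A = "all_facilities N n s"
  have "?A \<noteq> {}"
    using assms facilities_nonempty[of n 1 s] by (auto simp: all_facilities_def)
  then obtain f where f: "f \<in> ?A" "\<bar>t - f\<bar> \<le> set_distance t ?A"
    using set_distance_le_iff[of ?A t "set_distance t ?A"] by auto
  then obtain i where i: "i \<in> {1..N}" "f \<in> facilities n s i"
    by (auto simp: all_facilities_def)
  then have "set_distance t (facilities n s i) \<le> set_distance t ?A"
    using f by (subst set_distance_le_iff) auto
  with i show ?thesis by (auto simp: nearest_players_def)
qed

lemma share_nonneg: "0 \<le> share N n i s t"
  by (simp add: share_def)

lemma share_le_1: "share N n i s t \<le> 1"
proof (cases "i \<in> nearest_players N n s t")
  case True
  then have "0 < card (nearest_players N n s t)" by (auto simp: card_gt_0_iff)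
  then show ?thesis by (simp add: share_def field_simps)
qed (simp add: share_def)

text \<open>The owner of a facility nearest to \<open>t\<close> is a nearest player, so the common
  denominator is not 0.\<close>

lemma sum_share:
  assumes "\<forall>i\<in>{1..N}. 0 < n i" "1 \<le> N"
  shows "(\<Sum>i=1..N. share N n i s t) = 1"
proof -
  have "card (nearest_players N n s t) \<noteq> 0"
    using nearest_players_nonempty[OF assms] by simp
  moreover have "{1..N} \<inter> nearest_players N n s t = nearest_players N n s t"
    by (auto simp: nearest_players_def)
  ultimately show ?thesis
    by (simp add: share_def of_bool_def sum_divide_distrib[symmetric] sum.If_cases Int_def)
qed

lemma share_le_half:
  assumes "k \<in> nearest_players N n s t" "k \<noteq> i"
  shows "share N n i s t \<le> 1 / 2"
proof (cases "i \<in> nearest_players N n s t")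
  case True
  then have "card {i, k} \<le> card (nearest_players N n s t)"
    using assms by (intro card_mono) auto
  then have "2 \<le> real (card (nearest_players N n s t))" using assms by simp
  then show ?thesis using True by (simp add: share_def field_simps)
qed (simp add: share_def)

text \<open>Player \<open>i\<close> is served at \<open>t\<close> only through a facility no farther
  than \<open>g\<close>. If it is strictly closer, its cover is 1; if it is equally far,
  \<open>k\<close> ties and the share is at most 1/2. The rival \<open>k\<close> need only own a
  grid point nearest to this one \<open>t\<close>, so the bound also works when single grid points
  are occupied.\<close>

lemma share_le_cover:
  assumes i: "i \<in> {1..N}" "0 < n i" and k: "k \<in> {1..N}" "k \<noteq> i"
    and g: "g \<in> facilities n s k" "\<bar>t - g\<bar> = set_distance t (grid K)"
  shows "share N n i s t \<le> (\<Sum>l=1..n i. cover K (s i l) t)"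
proof (cases "i \<in> nearest_players N n s t")
  case True
  then obtain l where l: "l \<in> {1..n i}"
    and least: "\<forall>k\<in>{1..N}. \<forall>f'\<in>facilities n s k. \<bar>t - s i l\<bar> \<le> \<bar>t - f'\<bar>"
    unfolding nearest_players_iff[of i N n s t, OF i] facilities_def[of n s i] by blast
  have "\<bar>t - s i l\<bar> \<le> \<bar>t - g\<bar>" using least k(1) g(1) by blast
  then have le: "\<bar>t - s i l\<bar> \<le> set_distance t (grid K)" by (simp only: g(2))
  have "share N n i s t \<le> cover K (s i l) t"
  proof (cases "\<bar>t - s i l\<bar> = set_distance t (grid K)")
    case True
    have "0 < n k" using g by (auto simp: facilities_def)
    moreover have "\<forall>k\<in>{1..N}. \<forall>f'\<in>facilities n s k. \<bar>t - g\<bar> \<le> \<bar>t - f'\<bar>"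
      using least by (simp only: True g(2))
    ultimately have "k \<in> nearest_players N n s t"
      using nearest_players_iff[of k N n s t, OF k(1)] g(1) by blast
    from share_le_half[OF this k(2)] True show ?thesis by (simp add: cover_def)
  qed (use le share_le_1 in \<open>auto simp: cover_def\<close>)
  also have "\<dots> \<le> (\<Sum>l=1..n i. cover K (s i l) t)"
    using l by (intro member_le_sum) (auto simp: cover_nonneg)
  finally show ?thesis .
qed (simp add: share_def sum_nonneg cover_nonneg)

text \<open>Profile and customer vary together, which gives both measurability in \<open>t\<close>
  for a fixed profile and joint measurability. The cardinality is handled as a finite sum of
  indicators.\<close>

lemma borel_measurable_share:
  assumes [measurable]: "\<And>i j. i \<in> {1..N} \<Longrightarrow> j \<in> {1..n i} \<Longrightarrow> (\<lambda>x. f x i j) \<in> borel_measurable M"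
    and [measurable]: "g \<in> borel_measurable M"
  shows "(\<lambda>x. share N n i (f x) (g x)) \<in> borel_measurable M"
proof -
  have *: "set_distance t (facilities n s i) = Min ((\<lambda>j. \<bar>t - s i j\<bar>) ` {1..n i})" for s t i
    by (simp add: set_distance_def facilities_def image_image)
  have all: "all_facilities N n s = (\<lambda>(i, j). s i j) ` (SIGMA i:{1..N}. {1..n i})" for s
    by (force simp: all_facilities_def facilities_def)
  have **: "set_distance t (all_facilities N n s) =
      Min ((\<lambda>p. \<bar>t - s (fst p) (snd p)\<bar>) ` (SIGMA i:{1..N}. {1..n i}))" for s t
    by (simp add: set_distance_def all image_image case_prod_beta)
  have m1: "(\<lambda>x. set_distance (g x) (facilities n (f x) k)) \<in> borel_measurable M"
    if "k \<in> {1..N}" for k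
    unfolding * using that by (intro borel_measurable_Min) auto
  have m2: "(\<lambda>x. set_distance (g x) (all_facilities N n (f x))) \<in> borel_measurable M"
    unfolding ** by (intro borel_measurable_Min) auto
  have nearest: "Measurable.pred M (\<lambda>x. k \<in> nearest_players N n (f x) (g x))" for k
  proof (cases "k \<in> {1..N}")
    case True
    note m1[OF True, measurable] and m2[measurable]
    have "(\<lambda>x. k \<in> nearest_players N n (f x) (g x)) =
        (\<lambda>x. set_distance (g x) (facilities n (f x) k) \<le> set_distance (g x) (all_facilities N n (f x)))"
      using True by (auto simp: nearest_players_def)
    then show ?thesis by (simp only:) measurable
  next
    case False
    then have "(\<lambda>x. k \<in> nearest_players N n (f x) (g x)) = (\<lambda>x. False)"
      by (auto simp: nearest_players_def)
    then show ?thesis by (simp only:) measurable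
  qed
  note nearest[measurable]
  have card: "real (card (nearest_players N n s t)) =
      (\<Sum>k=1..N. if k \<in> nearest_players N n s t then 1 else 0)" for s t
  proof -
    have "{1..N} \<inter> nearest_players N n s t = nearest_players N n s t"
      by (auto simp: nearest_players_def)
    then show ?thesis by (simp add: sum.If_cases Int_def)
  qed
  show ?thesis unfolding share_def of_bool_def card by measurable
qed

section \<open>Bounds on pure payoffs\<close>

lemma pure_payoff_eq: "pure_payoff N n i s = (LINT t:{0..1}|lborel. share N n i s t)"
  by (simp add: pure_payoff_def share_def)

lemma set_integrable_share: "set_integrable lborel {0..1} (share N n i s)"
proof (rule set_integrable_bounded)
  show "share N n i s \<in> borel_measurable borel"
    by (rule borel_measurable_share[of N n "\<lambda>_. s" borel "\<lambda>t. t" i]) simp_all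
  show "\<bar>share N n i s t\<bar> \<le> 1" for t
    by (simp add: share_nonneg share_le_1)
qed auto

text \<open>The game has constant sum, so upper bounds for the weak players become a lower bound for
  the dominant one.\<close>

lemma sum_pure_payoff:
  assumes "\<forall>i\<in>{1..N}. 0 < n i" "1 \<le> N"
  shows "(\<Sum>i=1..N. pure_payoff N n i s) = 1"
proof -
  have "(\<Sum>i=1..N. pure_payoff N n i s) = (LINT t:{0..1::real}|lborel. (\<Sum>i=1..N. share N n i s t))"
    unfolding pure_payoff_eq by (intro set_lebesgue_integral_sum[symmetric] set_integrable_share)
  then show ?thesis
    by (simp only: sum_share[OF assms]) (simp add: set_lebesgue_integral_def)
qed

lemma pure_payoff_nonneg: "0 \<le> pure_payoff N n i s"
  unfolding pure_payoff_eq set_lebesgue_integral_def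
  by (rule Bochner_Integration.integral_nonneg) (simp add: share_nonneg)

lemma pure_payoff_le_1: "pure_payoff N n i s \<le> 1"
proof -
  have "pure_payoff N n i s \<le> (LINT t:{0..1::real}|lborel. 1)"
    unfolding pure_payoff_eq
    by (intro set_integral_mono set_integrable_share share_le_1) (simp add: set_integrable_def)
  then show ?thesis by (simp add: set_lebesgue_integral_def)
qed

text \<open>Owning the whole grid, \<open>k\<close> owns a grid point nearest to every customer.
  Hence \<open>share_le_cover\<close> holds on all of [0,1], and each of the \<open>n i\<close>
  facilities contributes at most \<open>1 / (2 * real K)\<close>.\<close>

lemma pure_payoff_le_against_grid:
  assumes i: "i \<in> {1..N}" "0 < n i" and k: "k \<in> {1..N}" "k \<noteq> i" "facilities n s k = grid K"
    and K: "0 < K" and s: "s i ` {1..n i} \<subseteq> {0..1}"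
  shows "pure_payoff N n i s \<le> real (n i) / (2 * real K)"
proof -
  have "share N n i s t \<le> (\<Sum>l=1..n i. cover K (s i l) t)" for t
  proof -
    obtain g where "g \<in> grid K" "\<bar>t - g\<bar> \<le> set_distance t (grid K)"
      using set_distance_le_iff[OF finite_grid grid_nonempty[OF K], of t "set_distance t (grid K)"]
      by blast
    moreover from this have "set_distance t (grid K) \<le> \<bar>t - g\<bar>"
      by (subst set_distance_le_iff) auto
    ultimately show ?thesis using share_le_cover[of i N n k g s t K, OF i k(1,2)] by (simp add: k(3))
  qed
  then have "pure_payoff N n i s \<le> (LINT t:{0..1::real}|lborel. (\<Sum>l=1..n i. cover K (s i l) t))"
    unfolding pure_payoff_eq
    by (intro set_integral_mono set_integrable_share set_integrable_sum set_integrable_cover) auto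
  also have "\<dots> = (\<Sum>l=1..n i. LINT t:{0..1}|lborel. cover K (s i l) t)"
    by (intro set_lebesgue_integral_sum set_integrable_cover) auto
  also have "\<dots> \<le> (\<Sum>l=1..n i. 1 / (2 * real K))"
    using s K by (intro sum_mono integral_cover_le) blast+
  finally show ?thesis by simp
qed

text \<open>In the cell of a grid point held by \<open>i\<close>, all other grid points are strictly
  farther, and only \<open>N\<close> can share this one. So \<open>i\<close> gets at least 1/2 on
  each of \<open>card J\<close> disjoint cells of length \<open>1 / K\<close>.\<close>

lemma pure_payoff_ge_on_grid:
  assumes pos: "\<forall>k\<in>{1..N}. 0 < n k" and i: "i \<in> {1..N}" "i \<noteq> N" and K: "0 < K"
    and J: "J \<subseteq> {..<K}" "facilities n s i = grid_point K ` J"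
    and all: "\<And>k. k \<in> {1..N} \<Longrightarrow> facilities n s k \<subseteq> grid K"
    and disj: "\<And>k. k \<in> {1..N} \<Longrightarrow> k \<noteq> i \<Longrightarrow> k \<noteq> N \<Longrightarrow> facilities n s k \<inter> facilities n s i = {}"
  shows "real (card J) / (2 * real K) \<le> pure_payoff N n i s"
proof -
  have fin: "finite J" using J(1) finite_subset by blast
  have half: "1 / 2 \<le> share N n i s t" if t: "t \<in> cell K j" and j: "j \<in> J" for t j
  proof -
    have nearest: "f = grid_point K j" if "f \<in> grid K" "\<bar>t - f\<bar> \<le> \<bar>t - grid_point K j\<bar>" for f
      using that nearest_grid_point_unique[OF t _ K] by (auto simp: grid_def)
    have gj: "grid_point K j \<in> facilities n s i" using J j by simp
    have far: "\<bar>t - grid_point K j\<bar> \<le> \<bar>t - f\<bar>" if "f \<in> grid K" for f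
      using nearest[OF that] by linarith
    have in': "i \<in> nearest_players N n s t"
    proof (subst nearest_players_iff)
      show "\<exists>f\<in>facilities n s i. \<forall>k\<in>{1..N}. \<forall>f'\<in>facilities n s k. \<bar>t - f\<bar> \<le> \<bar>t - f'\<bar>"
        using gj all far by (intro bexI[of _ "grid_point K j"]) blast+
    qed (use i pos in auto)
    have "nearest_players N n s t \<subseteq> {i, N}"
    proof
      fix k assume k: "k \<in> nearest_players N n s t"
      then have kN: "k \<in> {1..N}" by (simp add: nearest_players_def)
      then have "\<exists>f\<in>facilities n s k. \<forall>k\<in>{1..N}. \<forall>f'\<in>facilities n s k. \<bar>t - f\<bar> \<le> \<bar>t - f'\<bar>"
        using k pos nearest_players_iff[of k N n s t] by metis
      then obtain f where f: "f \<in> facilities n s k" "\<bar>t - f\<bar> \<le> \<bar>t - grid_point K j\<bar>"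
        using gj i by blast
      then have "f = grid_point K j" using nearest all[OF kN] by auto
      then show "k \<in> {i, N}" using f gj disj[OF kN] by auto
    qed
    then have "card (nearest_players N n s t) \<le> card {i, N}" by (intro card_mono) auto
    moreover have "card {i, N} \<le> 2" by (simp add: card_insert_if)
    moreover have "0 < card (nearest_players N n s t)" using in' by (auto simp: card_gt_0_iff)
    ultimately show ?thesis using in' by (simp add: share_def field_simps)
  qed
  have "real (card J) / (2 * real K) = (LINT t|lborel. (\<Sum>j\<in>J. indicator (cell K j) t / 2))"
    using K by (subst Bochner_Integration.integral_sum) (auto simp: measure_cell integrable_cell)
  also have "\<dots> \<le> pure_payoff N n i s"
    unfolding pure_payoff_eq set_lebesgue_integral_def
  proof (rule Bochner_Integration.integral_mono)
    show "integrable lborel (\<lambda>t. \<Sum>j\<in>J. indicator (cell K j) t / 2 :: real)"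
      using K integrable_cell by auto
    show "integrable lborel (\<lambda>t. indicator {0..1} t *\<^sub>R share N n i s t)"
      using set_integrable_share by (simp add: set_integrable_def)
    fix t
    show "(\<Sum>j\<in>J. indicator (cell K j) t / 2) \<le> indicator {0..1} t *\<^sub>R share N n i s t"
    proof (cases "\<exists>j\<in>J. t \<in> cell K j")
      case True
      then obtain j where j: "j \<in> J" "t \<in> cell K j" by auto
      from j have "(\<Sum>j\<in>J. indicator (cell K j) t / 2 :: real) = (\<Sum>j'\<in>J. if j' = j then 1 / 2 else 0)"
        using cell_disjoint[OF K] by (intro sum.cong) (auto simp: indicator_def)
      also have "\<dots> = 1 / 2" using j fin by simp
      also have "\<dots> \<le> indicator {0..1} t *\<^sub>R share N n i s t"
      proof -
        have "t \<in> {0..1}" using j cell_subset[of j K] J by blast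
        then show ?thesis using half[OF j(2,1)] by simp
      qed
      finally show ?thesis .
    next
      case False
      then show ?thesis by (simp add: share_nonneg)
    qed
  qed
  finally show ?thesis .
qed

text \<open>The cells are disjoint parts of [0,1]. Splitting the single-facility bound over them
  allows each cell to be weighted by the probability that its grid point is occupied.\<close>

lemma sum_integral_cell_cover_le:
  assumes "0 < K" "u \<in> {0..1}"
  shows "(\<Sum>j<K. LINT t:cell K j|lborel. cover K u t) \<le> 1 / (2 * real K)"
proof -
  have int: "integrable lborel (\<lambda>t. indicator (cell K j) t *\<^sub>R cover K u t)" if "j < K" for j
    using set_integrable_cover[OF borel_cell cell_subset[OF that], of K u]
    by (simp add: set_integrable_def)
  have "(\<Sum>j<K. LINT t:cell K j|lborel. cover K u t) =
      (LINT t|lborel. (\<Sum>j<K. indicator (cell K j) t *\<^sub>R cover K u t))"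
    unfolding set_lebesgue_integral_def
    using int by (intro Bochner_Integration.integral_sum[symmetric]) auto
  also have "\<dots> \<le> (LINT t:{0..1}|lborel. cover K u t)"
    unfolding set_lebesgue_integral_def
  proof (rule Bochner_Integration.integral_mono)
    show "integrable lborel (\<lambda>t. \<Sum>j<K. indicator (cell K j) t *\<^sub>R cover K u t)"
      using int by (intro Bochner_Integration.integrable_sum) auto
    show "integrable lborel (\<lambda>t. indicator {0..1} t *\<^sub>R cover K u t)"
      using set_integrable_cover[of "{0..1}" K u] by (simp add: set_integrable_def)
    fix t
    show "(\<Sum>j<K. indicator (cell K j) t *\<^sub>R cover K u t) \<le> indicator {0..1} t *\<^sub>R cover K u t"
    proof (cases "\<exists>j<K. t \<in> cell K j")
      case True
      then obtain j where j: "j < K" "t \<in> cell K j" by auto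
      then have "(\<Sum>j<K. indicator (cell K j) t *\<^sub>R cover K u t) =
          (\<Sum>j'<K. if j' = j then cover K u t else 0)"
        using cell_disjoint[OF assms(1)] by (intro sum.cong) (auto simp: indicator_def)
      also have "\<dots> = cover K u t" using j by simp
      also have "\<dots> = indicator {0..1} t *\<^sub>R cover K u t"
        using j cell_subset[OF j(1)] by (simp add: subset_iff)
      finally show ?thesis by (rule eq_refl)
    next
      case False
      then show ?thesis by (simp add: cover_nonneg)
    qed
  qed
  also have "\<dots> \<le> 1 / (2 * real K)" using assms by (intro integral_cover_le)
  finally show ?thesis .
qed

text \<open>The share is at most the total cover on a cell whose grid point is occupied by the
  designated rival \<open>own j\<close>, and at most 1 elsewhere. A summand may be negative, since
  covers can add up to more than 1; the bound holds regardless. The occupation indicators enter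
  linearly, ready for expectations.\<close>

lemma pure_payoff_le_uncovered:
  assumes i: "i \<in> {1..N}" "0 < n i" and K: "0 < K"
    and own: "\<And>j. j < K \<Longrightarrow> own j \<in> {1..N} \<and> own j \<noteq> i"
  shows "pure_payoff N n i s \<le>
    1 - (\<Sum>j<K. of_bool (grid_point K j \<in> facilities n s (own j)) *
           (1 / real K - (\<Sum>l=1..n i. LINT t:cell K j|lborel. cover K (s i l) t)))"
proof -
  let ?J = "{j\<in>{..<K}. grid_point K j \<in> facilities n s (own j)}"
  let ?W = "\<lambda>t. \<Sum>l=1..n i. cover K (s i l) t"
  have intW: "integrable lborel (\<lambda>t. indicator (cell K j) t * (1 - ?W t))"
    and valW: "(LINT t|lborel. indicator (cell K j) t * (1 - ?W t)) =
      1 / real K - (\<Sum>l=1..n i. LINT t:cell K j|lborel. cover K (s i l) t)" if "j < K" for j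
  proof -
    have 1: "integrable lborel (\<lambda>t. indicator (cell K j) t * cover K u t)" for u
      using set_integrable_cover[OF borel_cell cell_subset[OF that], of K u]
      by (simp add: set_integrable_def)
    have 2: "integrable lborel (\<lambda>t. indicator (cell K j) t :: real)"
      by (rule integrable_cell[OF K])
    have eq: "indicator (cell K j) t * (1 - ?W t) =
       indicator (cell K j) t - (\<Sum>l=1..n i. indicator (cell K j) t * cover K (s i l) t)" for t
      by (simp add: right_diff_distrib sum_distrib_left)
    show "integrable lborel (\<lambda>t. indicator (cell K j) t * (1 - ?W t))"
      unfolding eq using 1 2 by (intro Bochner_Integration.integrable_diff Bochner_Integration.integrable_sum)
    show "(LINT t|lborel. indicator (cell K j) t * (1 - ?W t)) =
      1 / real K - (\<Sum>l=1..n i. LINT t:cell K j|lborel. cover K (s i l) t)"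
      unfolding eq set_lebesgue_integral_def
      using K by (subst Bochner_Integration.integral_diff[OF 2 Bochner_Integration.integrable_sum[OF 1]],
        subst Bochner_Integration.integral_sum[OF 1]) (simp add: measure_cell)
  qed
  have "pure_payoff N n i s \<le>
      (LINT t|lborel. indicator {0..1} t - (\<Sum>j\<in>?J. indicator (cell K j) t * (1 - ?W t)))"
    unfolding pure_payoff_eq set_lebesgue_integral_def
  proof (rule Bochner_Integration.integral_mono)
    show "integrable lborel (\<lambda>t. indicator {0..1} t *\<^sub>R share N n i s t)"
      using set_integrable_share by (simp add: set_integrable_def)
    show "integrable lborel (\<lambda>t. indicator {0..1} t - (\<Sum>j\<in>?J. indicator (cell K j) t * (1 - ?W t)))"
      by (intro Bochner_Integration.integrable_diff Bochner_Integration.integrable_sum intW integrable_real_indicator) auto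
    fix t :: real
    show "indicator {0..1} t *\<^sub>R share N n i s t \<le>
        indicator {0..1} t - (\<Sum>j\<in>?J. indicator (cell K j) t * (1 - ?W t))"
    proof (cases "\<exists>j\<in>?J. t \<in> cell K j")
      case True
      then obtain j where j: "j < K" "grid_point K j \<in> facilities n s (own j)" "t \<in> cell K j"
        by auto
      then have "(\<Sum>j\<in>?J. indicator (cell K j) t * (1 - ?W t)) =
          (\<Sum>j'\<in>?J. if j' = j then 1 - ?W t else 0)"
        using cell_disjoint[OF K] by (intro sum.cong) (auto simp: indicator_def)
      also have "\<dots> = 1 - ?W t" using j by (subst sum.delta) auto
      finally have sum: "(\<Sum>j\<in>?J. indicator (cell K j) t * (1 - ?W t)) = 1 - ?W t" .
      have "t \<in> {0..1}" using cell_subset[OF j(1)] j(3) by blast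
      moreover have "share N n i s t \<le> ?W t"
        using share_le_cover[of i N n "own j" "grid_point K j" s t K, OF i _ _ j(2)]
          own[OF j(1)] set_distance_grid_in_cell[OF j(3,1)] by simp
      ultimately show ?thesis unfolding sum by simp
    next
      case False
      then show ?thesis by (auto simp: share_le_1 indicator_def)
    qed
  qed
  also have "\<dots> = 1 - (\<Sum>j\<in>?J. 1 / real K - (\<Sum>l=1..n i. LINT t:cell K j|lborel. cover K (s i l) t))"
  proof -
    have integrable_unit: "integrable lborel (indicator {0..1} :: real \<Rightarrow> real)"
      by (rule integrable_real_indicator) simp_all
    have int: "integrable lborel (\<lambda>t. \<Sum>j\<in>?J. indicator (cell K j) t * (1 - ?W t))"
      by (intro Bochner_Integration.integrable_sum intW) auto
    have "(LINT t|lborel. (\<Sum>j\<in>?J. indicator (cell K j) t * (1 - ?W t))) =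
        (\<Sum>j\<in>?J. LINT t|lborel. indicator (cell K j) t * (1 - ?W t))"
      by (intro Bochner_Integration.integral_sum intW) auto
    also have "\<dots> = (\<Sum>j\<in>?J. 1 / real K - (\<Sum>l=1..n i. LINT t:cell K j|lborel. cover K (s i l) t))"
      by (intro sum.cong valW) auto
    finally show ?thesis
      unfolding Bochner_Integration.integral_diff[OF integrable_unit int] by simp
  qed
  also have "(\<Sum>j\<in>?J. 1 / real K - (\<Sum>l=1..n i. LINT t:cell K j|lborel. cover K (s i l) t)) =
     (\<Sum>j<K. of_bool (grid_point K j \<in> facilities n s (own j)) *
           (1 / real K - (\<Sum>l=1..n i. LINT t:cell K j|lborel. cover K (s i l) t)))"
    by (intro sum.mono_neutral_cong_left) auto
  finally show ?thesis .
qed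

section \<open>Mixed strategies on the grid\<close>

lemma pure_strategy_in_unit: "s \<in> pure_strategies k \<Longrightarrow> l \<in> {1..k} \<Longrightarrow> s l \<in> {0..1}"
  unfolding pure_strategies_def by (blast dest: PiE_mem)

lemma space_strategy_space [simp]: "space (strategy_space k) = pure_strategies k"
  by (auto simp: strategy_space_def space_restrict_space space_PiM pure_strategies_def)

lemma measurable_strategy_component:
  "l \<in> {1..k} \<Longrightarrow> (\<lambda>s. s l) \<in> borel_measurable (strategy_space k)"
  unfolding strategy_space_def by (intro measurable_restrict_space1 measurable_component_singleton)

lemma measurable_mixed_strategy_component:
  assumes "\<mu> \<in> mixed_strategies k" "l \<in> {1..k}"
  shows "(\<lambda>s. s l) \<in> borel_measurable \<mu>"
proof -
  have "measurable \<mu> (borel :: real measure) = borel_measurable (strategy_space k)"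
    using assms(1) by (intro measurable_cong_sets) (auto simp: mixed_strategies_def)
  with measurable_strategy_component[OF assms(2)] show ?thesis by (simp only:)
qed

lemma prob_space_mixed_strategy: "\<mu> \<in> mixed_strategies k \<Longrightarrow> prob_space \<mu>"
  by (simp add: mixed_strategies_def)

lemma space_mixed_strategy: "\<mu> \<in> mixed_strategies k \<Longrightarrow> space \<mu> = pure_strategies k"
  using sets_eq_imp_space_eq[of \<mu> "strategy_space k"] by (simp add: mixed_strategies_def)

text \<open>The share is jointly measurable in profile and customer, and the customer is integrated
  out.\<close>

lemma borel_measurable_pure_payoff:
  assumes x: "\<forall>i\<in>{1..N}. x i \<in> mixed_strategies (n i)"
  shows "pure_payoff N n i \<in> borel_measurable (\<Pi>\<^sub>M j\<in>{1..N}. x j)"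
proof -
  let ?P = "\<Pi>\<^sub>M j\<in>{1..N}. x j"
  have comp: "(\<lambda>p. fst p k l) \<in> borel_measurable (?P \<Otimes>\<^sub>M lborel)"
    if "k \<in> {1..N}" "l \<in> {1..n k}" for k l
  proof -
    have "(\<lambda>p. fst p k) \<in> measurable (?P \<Otimes>\<^sub>M lborel) (x k)"
      using measurable_compose[OF measurable_fst measurable_component_singleton[OF that(1)]] .
    from measurable_compose[OF this measurable_mixed_strategy_component[OF bspec[OF x that(1)] that(2)]]
    show ?thesis .
  qed
  have ind: "(\<lambda>p. indicator {0..1} (snd p) :: real) \<in> borel_measurable (?P \<Otimes>\<^sub>M (lborel :: real measure))"
    by measurable
  have "(\<lambda>p. share N n i (fst p) (snd p)) \<in> borel_measurable (?P \<Otimes>\<^sub>M lborel)"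
    by (rule borel_measurable_share[OF comp]) simp_all
  then have "(\<lambda>(s, t). indicator {0..1} t *\<^sub>R share N n i s t) \<in> borel_measurable (?P \<Otimes>\<^sub>M lborel)"
    unfolding case_prod_beta by (rule borel_measurable_scaleR[OF ind])
  from lborel.borel_measurable_lebesgue_integral[OF this]
  show ?thesis by (simp add: pure_payoff_eq[abs_def] set_lebesgue_integral_def)
qed

lemma
  assumes x: "\<forall>i\<in>{1..N}. x i \<in> mixed_strategies (n i)"
  shows prob_space_profile: "prob_space (\<Pi>\<^sub>M j\<in>{1..N}. x j)"
    and integrable_pure_payoff: "integrable (\<Pi>\<^sub>M j\<in>{1..N}. x j) (pure_payoff N n i)"
proof -
  show P: "prob_space (\<Pi>\<^sub>M j\<in>{1..N}. x j)"
    using x prob_space_mixed_strategy by (intro prob_space_PiM) blast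
  show "integrable (\<Pi>\<^sub>M j\<in>{1..N}. x j) (pure_payoff N n i)"
  proof (rule finite_measure.integrable_const_bound)
    show "finite_measure (\<Pi>\<^sub>M j\<in>{1..N}. x j)" using P by (rule prob_space.finite_measure)
    show "AE s in \<Pi>\<^sub>M j\<in>{1..N}. x j. norm (pure_payoff N n i s) \<le> 1"
      by (simp add: pure_payoff_nonneg pure_payoff_le_1)
  qed (rule borel_measurable_pure_payoff[OF x])
qed

text \<open>Independence of two coordinates; all others integrate to 1.\<close>

lemma integral_PiM_mult:
  fixes f g :: "'a \<Rightarrow> real"
  assumes M: "\<And>i. i \<in> I \<Longrightarrow> prob_space (M i)" and I: "finite I" "i \<in> I" "k \<in> I" "i \<noteq> k"
    and f: "integrable (M i) f" and g: "integrable (M k) g"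
  shows "integrable (Pi\<^sub>M I M) (\<lambda>s. f (s i) * g (s k))"
    and "(LINT s|Pi\<^sub>M I M. f (s i) * g (s k)) = (LINT y|M i. f y) * (LINT y|M k. g y)"
proof -
  \<comment> \<open>\<open>product_sigma_finite\<close> asks for sigma-finiteness at every index, so
    a point mass is placed outside \<open>I\<close>.\<close>
  define M' where "M' l = (if l \<in> I then M l else return (count_space UNIV) undefined)" for l
  have M': "prob_space (M' l)" for l
    using M by (auto simp: M'_def intro: prob_space_return)
  have psf: "product_sigma_finite M'"
    by (rule product_sigma_finite.intro) (rule prob_space_imp_sigma_finite[OF M'])
  have eq: "Pi\<^sub>M I M = Pi\<^sub>M I M'"
    by (rule PiM_cong) (auto simp: M'_def)
  define h where "h l = (if l = i then f else if l = k then g else (\<lambda>_. 1))" for l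
  have h: "integrable (M' l) (h l)" if "l \<in> I" for l
    using f g that I finite_measure.integrable_const[OF prob_space.finite_measure[OF M[OF that]], of "1::real"]
    by (auto simp: h_def M'_def)
  have prod: "(\<Prod>l\<in>I. F l) = F i * F k" if "\<And>l. l \<in> I - {i, k} \<Longrightarrow> F l = 1" for F :: "_ \<Rightarrow> real"
  proof -
    have "(\<Prod>l\<in>I. F l) = (\<Prod>l\<in>{i, k}. F l)"
      using I that by (intro prod.mono_neutral_right) auto
    then show ?thesis using I by simp
  qed
  have h_prod: "(\<Prod>l\<in>I. h l (s l)) = f (s i) * g (s k)" for s
    by (subst prod) (use I in \<open>auto simp: h_def\<close>)
  show "integrable (Pi\<^sub>M I M) (\<lambda>s. f (s i) * g (s k))"
    using product_sigma_finite.product_integrable_prod[OF psf I(1) h] by (simp add: h_prod eq)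
  have "(LINT s|Pi\<^sub>M I M. f (s i) * g (s k)) = (\<Prod>l\<in>I. LINT y|M' l. h l y)"
    using product_sigma_finite.product_integral_prod[OF psf I(1) h] by (simp add: h_prod eq)
  also have "\<dots> = (LINT y|M i. f y) * (LINT y|M k. g y)"
    by (subst prod) (use I prob_space.prob_space[OF M] in \<open>auto simp: h_def M'_def\<close>)
  finally show "(LINT s|Pi\<^sub>M I M. f (s i) * g (s k)) = (LINT y|M i. f y) * (LINT y|M k. g y)" .
qed

section \<open>Random subsets of the grid as mixed strategies\<close>

definition grid_strategy :: "nat \<Rightarrow> nat set \<Rightarrow> nat \<Rightarrow> real" where
  "grid_strategy K A = (\<lambda>l\<in>{1..card A}. grid_point K (sorted_list_of_set A ! (l - 1)))"

text \<open>For finite \<open>B\<close> and \<open>k = card B\<close> the only choice is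
  \<open>B\<close> itself, so the deterministic strategy of the dominant player is a special
  case.\<close>

definition grid_mix :: "nat \<Rightarrow> nat \<Rightarrow> nat set \<Rightarrow> (nat \<Rightarrow> real) measure" where
  "grid_mix K k B =
     distr (uniform_count_measure {A. A \<subseteq> B \<and> card A = k}) (strategy_space k) (grid_strategy K)"

lemma grid_point_less: "i < j \<Longrightarrow> 0 < K \<Longrightarrow> grid_point K i < grid_point K j"
  by (simp add: grid_point_def divide_strict_right_mono)

lemma inj_grid_point: "0 < K \<Longrightarrow> inj (grid_point K)"
  by (intro injI) (simp add: grid_point_def)

lemma grid_point_in_unit: "j < K \<Longrightarrow> grid_point K j \<in> {0..1}"
  by (auto simp: grid_point_def field_simps)

lemma grid_strategy_image:
  assumes "finite A"
  shows "grid_strategy K A ` {1..card A} = grid_point K ` A"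
proof -
  \<comment> \<open>Strategies are indexed from 1, list positions from 0.\<close>
  have "(\<lambda>l. sorted_list_of_set A ! (l - 1)) ` {1..card A} = (!) (sorted_list_of_set A) ` {..<card A}"
    by (force simp: image_iff intro: bexI[of _ "Suc _"])
  also have "\<dots> = A"
    using assms set_conv_nth[of "sorted_list_of_set A"] by (auto simp: image_def)
  finally have "(\<lambda>l. sorted_list_of_set A ! (l - 1)) ` {1..card A} = A" .
  from arg_cong[OF this, of "image (grid_point K)"] show ?thesis
    by (simp add: grid_strategy_def image_image cong: image_cong_simp)
qed

lemma grid_strategy_in_pure_strategies:
  assumes "A \<subseteq> {..<K}"
  shows "grid_strategy K A \<in> pure_strategies (card A)"
proof -
  have fin: "finite A" using assms finite_subset by blast
  have "strict_mono_on {1..card A} (grid_strategy K A)"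
  proof (intro strict_mono_onI)
    fix r s assume rs: "r \<in> {1..card A}" "s \<in> {1..card A}" "r < s"
    then have "sorted_list_of_set A ! (r - 1) < sorted_list_of_set A ! (s - 1)"
      using strict_sorted_list_of_set[of A] fin by (intro sorted_wrt_nth_less[of "(<)"]) auto
    moreover have "0 < K" using rs assms by (cases K) auto
    ultimately show "grid_strategy K A r < grid_strategy K A s"
      using rs by (simp add: grid_strategy_def grid_point_less del: One_nat_def)
  qed
  moreover have "grid_strategy K A ` {1..card A} \<subseteq> {0..1}"
    unfolding grid_strategy_image[OF fin] using assms grid_point_in_unit by blast
  moreover have "grid_strategy K A \<in> extensional {1..card A}"
    by (simp add: grid_strategy_def)
  ultimately show ?thesis by (auto simp: pure_strategies_def PiE_def)
qed

lemma finite_subsets_of_card: "finite B \<Longrightarrow> finite {A. A \<subseteq> B \<and> card A = k}"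
  by simp

lemma measurable_grid_strategy:
  assumes "B \<subseteq> {..<K}"
  shows "grid_strategy K \<in> measurable (uniform_count_measure {A. A \<subseteq> B \<and> card A = k}) (strategy_space k)"
  using assms grid_strategy_in_pure_strategies
  by (subst measurable_cong_sets[OF sets_uniform_count_measure_count_space refl]) auto

lemma grid_mix_in_mixed_strategies:
  assumes B: "B \<subseteq> {..<K}" and k: "k \<le> card B"
  shows "grid_mix K k B \<in> mixed_strategies k"
proof -
  have finB: "finite B" using B finite_subset by blast
  have "{A. A \<subseteq> B \<and> card A = k} \<noteq> {}"
    by (rule obtain_subset_with_card_n[OF k]) blast
  then have "prob_space (grid_mix K k B)"
    unfolding grid_mix_def
    by (intro prob_space.prob_space_distr prob_space_uniform_count_measure
        measurable_grid_strategy[OF B] finite_subsets_of_card[OF finB])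
  then show ?thesis by (simp add: mixed_strategies_def grid_mix_def)
qed

lemma AE_grid_mix:
  assumes B: "B \<subseteq> {..<K}"
  shows "AE s in grid_mix K k B. \<forall>l\<in>{1..k}. s l \<in> grid_point K ` B"
proof -
  have meas: "{s \<in> space (strategy_space k). \<forall>l\<in>{1..k}. s l \<in> grid_point K ` B} \<in> sets (strategy_space k)"
  proof (intro sets.sets_Collect_finite_All)
    fix l assume "l \<in> {1..k}"
    note [measurable] = measurable_strategy_component[OF this]
    have "finite (grid_point K ` B)" using B finite_subset by blast
    then have [measurable]: "grid_point K ` B \<in> sets borel"
      by (intro borel_closed finite_imp_closed)
    show "{s \<in> space (strategy_space k). s l \<in> grid_point K ` B} \<in> sets (strategy_space k)"
      by measurable
  qed simp
  have "\<forall>l\<in>{1..k}. grid_strategy K A l \<in> grid_point K ` B" if "A \<subseteq> B" "card A = k" for A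
    using grid_strategy_image[of A K] that finite_subset[OF that(1)] finite_subset[OF B] by blast
  then have "AE A in uniform_count_measure {A. A \<subseteq> B \<and> card A = k}.
      \<forall>l\<in>{1..k}. grid_strategy K A l \<in> grid_point K ` B"
    by (intro AE_I2) (simp add: space_uniform_count_measure)
  then show ?thesis
    unfolding grid_mix_def by (rule AE_distr_iff[OF measurable_grid_strategy[OF B] meas, THEN iffD2])
qed

text \<open>With \<open>b = card B\<close>, the fraction of \<open>k\<close>-subsets containing
  \<open>j\<close> is \<open>(b - 1 choose (k - 1)) / (b choose k)\<close>, which is
  \<open>k / b\<close> by binomial absorption.\<close>

lemma grid_mix_marginal:
  assumes B: "B \<subseteq> {..<K}" and k: "k \<le> card B" and j: "j \<in> B" and k0: "0 < k"
  shows "integrable (grid_mix K k B) (\<lambda>s. of_bool (grid_point K j \<in> s ` {1..k}) :: real)"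
    and "(LINT s|grid_mix K k B. of_bool (grid_point K j \<in> s ` {1..k})) = real k / real (card B)"
proof -
  let ?S = "{A. A \<subseteq> B \<and> card A = k}" and ?f = "\<lambda>s. of_bool (grid_point K j \<in> s ` {1..k}) :: real"
  have finB: "finite B" and K: "0 < K" using B finite_subset j by auto
  have "{s \<in> space (strategy_space k). \<exists>l\<in>{1..k}. s l = grid_point K j} \<in> sets (strategy_space k)"
  proof (intro sets.sets_Collect_finite_Ex)
    fix l assume "l \<in> {1..k}"
    note [measurable] = measurable_strategy_component[OF this]
    show "{s \<in> space (strategy_space k). s l = grid_point K j} \<in> sets (strategy_space k)"
      by measurable
  qed simp
  from borel_measurable_indicator[OF this, where 'b = real]
  have f: "?f \<in> borel_measurable (strategy_space k)"
    by (rule measurable_cong[THEN iffD1, rotated]) (force simp: indicator_def)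
  have P: "prob_space (grid_mix K k B)"
    using grid_mix_in_mixed_strategies[OF B k] by (rule prob_space_mixed_strategy)
  show "integrable (grid_mix K k B) ?f"
    by (rule finite_measure.integrable_const_bound[OF prob_space.finite_measure[OF P], where B = 1])
       (use f in \<open>auto simp: grid_mix_def\<close>)
  have "(LINT s|grid_mix K k B. ?f s) = (\<Sum>A\<in>?S. ?f (grid_strategy K A)) / real (card ?S)"
    unfolding grid_mix_def integral_distr[OF measurable_grid_strategy[OF B] f]
      integral_uniform_count_measure[OF finite_subsets_of_card[OF finB]] ..
  also have "(\<Sum>A\<in>?S. ?f (grid_strategy K A)) = (\<Sum>A\<in>?S. of_bool (j \<in> A))"
  proof (intro sum.cong refl)
    fix A assume A: "A \<in> ?S"
    then have "grid_strategy K A ` {1..k} = grid_point K ` A"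
      using grid_strategy_image[of A K] finite_subset[OF _ finB] by blast
    then show "?f (grid_strategy K A) = of_bool (j \<in> A)"
      by (simp only: inj_image_mem_iff[OF inj_grid_point[OF K]])
  qed
  also have "\<dots> = real (card {A \<in> ?S. j \<in> A})"
    using finite_subsets_of_card[OF finB] by (simp add: of_bool_def sum.If_cases Int_def)
  also have "card {A \<in> ?S. j \<in> A} = (card B - 1) choose (k - 1)"
  proof -
    \<comment> \<open>Deleting \<open>j\<close> is the inverse; \<open>k0\<close> makes
      \<open>k - 1\<close> a true predecessor.\<close>
    have "bij_betw (insert j) {A. A \<subseteq> B - {j} \<and> card A = k - 1} {A \<in> ?S. j \<in> A}"
    proof (rule bij_betw_byWitness[where f' = "\<lambda>A. A - {j}"])
      show "insert j ` {A. A \<subseteq> B - {j} \<and> card A = k - 1} \<subseteq> {A \<in> ?S. j \<in> A}"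
      proof (safe)
        fix A assume A: "A \<subseteq> B - {j}" "card A = k - 1"
        then have "finite A" "j \<notin> A" using finB finite_subset by auto
        then show "card (insert j A) = k" using A k0 by simp
      qed (use j in auto)
      show "(\<lambda>A. A - {j}) ` {A \<in> ?S. j \<in> A} \<subseteq> {A. A \<subseteq> B - {j} \<and> card A = k - 1}"
        by auto
    qed auto
    from bij_betw_same_card[OF this] show ?thesis
      using n_subsets[of "B - {j}" "k - 1"] finB j by simp
  qed
  also have "card ?S = card B choose k" using finB by (rule n_subsets)
  also have "real ((card B - 1) choose (k - 1)) / real (card B choose k) = real k / real (card B)"
  proof -
    have "k * (card B choose k) = card B * ((card B - 1) choose (k - 1))"
      using binomial_absorption[of "k - 1" "card B"] k0 by simp
    then have "real k * real (card B choose k) = real (card B) * real ((card B - 1) choose (k - 1))"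
      by (metis of_nat_mult)
    moreover have "0 < card B choose k" using k by simp
    ultimately show ?thesis using k k0 by (simp add: field_simps)
  qed
  finally show "(LINT s|grid_mix K k B. ?f s) = real k / real (card B)" .
qed

text \<open>\<open>J\<close> has as many elements as the disjoint union of blocks of sizes
  \<open>b i\<close>. Along a bijection, the block label serves as \<open>own\<close>.\<close>

lemma partition_with_cards:
  fixes b :: "'i \<Rightarrow> nat"
  assumes "finite J" "finite I" "card J = (\<Sum>i\<in>I. b i)"
  obtains own where "own \<in> J \<rightarrow> I" "\<And>i. i \<in> I \<Longrightarrow> card {j\<in>J. own j = i} = b i"
proof -
  have "card J = card (SIGMA i:I. {..<b i})" using assms by simp
  then obtain f where f: "bij_betw f J (SIGMA i:I. {..<b i})"
    using assms finite_same_card_bij by (metis finite_SigmaI finite_lessThan)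
  have "card {j\<in>J. fst (f j) = i} = b i" if "i \<in> I" for i
  proof -
    have "f ` {j\<in>J. fst (f j) = i} = {i} \<times> {..<b i}"
    proof (intro equalityI subsetI)
      fix y assume y: "y \<in> {i} \<times> {..<b i}"
      then have "y \<in> f ` J" unfolding bij_betw_imp_surj_on[OF f] using that by auto
      then obtain j where "j \<in> J" "f j = y" by blast
      then show "y \<in> f ` {j\<in>J. fst (f j) = i}" using y by force
    next
      fix y assume "y \<in> f ` {j\<in>J. fst (f j) = i}"
      then obtain j where j: "j \<in> J" "fst (f j) = i" "y = f j" by auto
      then have "f j \<in> (SIGMA i:I. {..<b i})" using bij_betwE[OF f] by blast
      then show "y \<in> {i} \<times> {..<b i}" using j by auto
    qed
    moreover have inj: "inj_on f {j\<in>J. fst (f j) = i}"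
      using bij_betw_imp_inj_on[OF f] by (rule inj_on_subset) simp
    ultimately have "card {j\<in>J. fst (f j) = i} = card ({i} \<times> {..<b i})"
      using card_image[OF inj] by (simp only:)
    then show ?thesis by simp
  qed
  moreover have "fst \<circ> f \<in> J \<rightarrow> I"
  proof
    fix j assume "j \<in> J"
    then have "f j \<in> (SIGMA i:I. {..<b i})" using bij_betwE[OF f] by blast
    then show "(fst \<circ> f) j \<in> I" by auto
  qed
  ultimately show ?thesis by (intro that[of "fst \<circ> f"]) simp_all
qed

lemma AE_profile_component:
  fixes N :: nat
  assumes "\<forall>i\<in>{1..N}. x i \<in> mixed_strategies (n i)" "i \<in> {1..N}" "AE y in x i. P y"
  shows "AE s in (\<Pi>\<^sub>M j\<in>{1..N}. x j). P (s i)"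
  using AE_PiM_component[of "{1..N}" x i P] assms prob_space_mixed_strategy by blast

lemma AE_pure_strategy:
  assumes "\<mu> \<in> mixed_strategies k"
  shows "AE s in \<mu>. s \<in> pure_strategies k"
  using AE_space[of \<mu>] by (simp only: space_mixed_strategy[OF assms])

lemma AE_profile_pure:
  fixes N :: nat
  assumes "\<forall>i\<in>{1..N}. x i \<in> mixed_strategies (n i)"
  shows "AE s in (\<Pi>\<^sub>M j\<in>{1..N}. x j). \<forall>i\<in>{1..N}. s i \<in> pure_strategies (n i)"
proof (rule AE_finite_allI)
  fix i assume i: "i \<in> {1..N}"
  show "AE s in (\<Pi>\<^sub>M j\<in>{1..N}. x j). s i \<in> pure_strategies (n i)"
    using assms i AE_pure_strategy[OF bspec[OF assms i]] by (rule AE_profile_component)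
qed simp

text \<open>Strict monotonicity makes the facilities distinct, so their index set has exactly
  \<open>k\<close> elements.\<close>

lemma pure_strategy_on_grid:
  assumes s: "s \<in> pure_strategies k" "\<forall>l\<in>{1..k}. s l \<in> grid_point K ` B" and K: "0 < K"
  obtains A where "A \<subseteq> B" "card A = k" "s ` {1..k} = grid_point K ` A"
proof -
  have "s ` {1..k} \<subseteq> grid_point K ` B" using s(2) by blast
  then obtain A where A: "A \<subseteq> B" "s ` {1..k} = grid_point K ` A"
    by (auto simp: subset_image_iff)
  have "inj_on s {1..k}"
    using s(1) by (auto simp: pure_strategies_def intro: strict_mono_on_imp_inj_on)
  from card_image[OF this] have "card (grid_point K ` A) = k" by (simp only: A card_atLeastAtMost)
  moreover have "card (grid_point K ` A) = card A"
    by (rule card_image[OF inj_on_subset[OF inj_grid_point[OF K] subset_UNIV]])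
  ultimately show ?thesis using A that by simp
qed

section \<open>Expected payoff against rivals with equal occupation probabilities\<close>

lemma borel_measurable_integral_cell_cover:
  "(\<lambda>u. LINT t:cell K j|lborel. cover K u t) \<in> borel_measurable borel"
proof -
  have "(\<lambda>(u, t). indicator (cell K j) t *\<^sub>R cover K u t) \<in> borel_measurable (borel \<Otimes>\<^sub>M lborel)"
    by measurable
  from lborel.borel_measurable_lebesgue_integral[OF this]
  show ?thesis by (simp add: set_lebesgue_integral_def)
qed

lemma integral_cell_cover_bounds:
  assumes "u \<in> {0..1}" "j < K"
  shows "0 \<le> (LINT t:cell K j|lborel. cover K u t)"
    and "(LINT t:cell K j|lborel. cover K u t) \<le> 1 / (2 * real K)"
proof -
  show *: "0 \<le> (LINT t:cell K j|lborel. cover K u t)" for j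
    unfolding set_lebesgue_integral_def
    by (rule Bochner_Integration.integral_nonneg) (simp add: cover_nonneg)
  have "(LINT t:cell K j|lborel. cover K u t) \<le> (\<Sum>j<K. LINT t:cell K j|lborel. cover K u t)"
    using assms(2) * by (intro member_le_sum) auto
  also have "\<dots> \<le> 1 / (2 * real K)"
    using assms by (intro sum_integral_cell_cover_le) auto
  finally show "(LINT t:cell K j|lborel. cover K u t) \<le> 1 / (2 * real K)" .
qed

text \<open>Expectations are taken in \<open>pure_payoff_le_uncovered\<close>. As
  \<open>own j\<close> differs from \<open>i\<close>, occupation of point \<open>j\<close> is
  independent of the strategy of \<open>i\<close>, so each summand factors into \<open>p\<close>
  times an expected loss. Nothing is assumed about \<open>x i\<close> beyond being a mixed strategy,
  so it may be any deviation.\<close>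

lemma payoff_le_against_marginals:
  assumes x: "\<forall>i\<in>{1..N}. x i \<in> mixed_strategies (n i)"
    and i: "i \<in> {1..N}" "n i = K" "0 < K"
    and own: "\<And>j. j < K \<Longrightarrow> own j \<in> {1..N} \<and> own j \<noteq> i"
    and int: "\<And>j. j < K \<Longrightarrow>
      integrable (x (own j)) (\<lambda>s. of_bool (grid_point K j \<in> s ` {1..n (own j)}) :: real)"
    and marg: "\<And>j. j < K \<Longrightarrow>
      (LINT s|x (own j). of_bool (grid_point K j \<in> s ` {1..n (own j)})) = p"
  shows "payoff N n i x \<le> 1 - p / 2"
proof -
  let ?P = "\<Pi>\<^sub>M j\<in>{1..N}. x j"
  \<comment> \<open>\<open>f j\<close> tells whether point \<open>j\<close> is occupied;
    \<open>h j\<close> is the part of the mass of cell \<open>j\<close> exceeding the total cover of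
    \<open>i\<close> there.\<close>
  define f where "f j s = (of_bool (grid_point K j \<in> s ` {1..n (own j)}) :: real)"
    for j and s :: "nat \<Rightarrow> real"
  define h where "h j s = 1 / real K - (\<Sum>l=1..n i. LINT t:cell K j|lborel. cover K (s l) t)"
    for j and s :: "nat \<Rightarrow> real"
  have P: "prob_space ?P" using x by (rule prob_space_profile)
  have Xi: "prob_space (x i)" using bspec[OF x i(1)] by (rule prob_space_mixed_strategy)
  have unit: "s l \<in> {0..1}" if "s \<in> space (x i)" "l \<in> {1..n i}" for s l
    using that pure_strategy_in_unit[of s "n i" l] by (simp only: space_mixed_strategy[OF bspec[OF x i(1)]])
  have int_h: "integrable (x i) (h j)" if "j < K" for j
    unfolding h_def
  proof (intro Bochner_Integration.integrable_diff Bochner_Integration.integrable_sum)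
    fix l assume l: "l \<in> {1..n i}"
    show "integrable (x i) (\<lambda>s. LINT t:cell K j|lborel. cover K (s l) t)"
    proof (rule finite_measure.integrable_const_bound[OF prob_space.finite_measure[OF Xi], where B = "1 / (2 * real K)"])
      show "AE s in x i. norm (LINT t:cell K j|lborel. cover K (s l) t) \<le> 1 / (2 * real K)"
        using integral_cell_cover_bounds[OF unit[OF _ l] that]
        by (intro AE_I2) (simp only: real_norm_def abs_of_nonneg)
      show "(\<lambda>s. LINT t:cell K j|lborel. cover K (s l) t) \<in> borel_measurable (x i)"
        using measurable_mixed_strategy_component[OF bspec[OF x i(1)] l] borel_measurable_integral_cell_cover
        by (rule measurable_compose)
    qed
  qed (rule finite_measure.integrable_const[OF prob_space.finite_measure[OF Xi]])
  \<comment> \<open>The cells have total mass 1, and \<open>K\<close> facilities cover at most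
    \<open>K * (1 / (2 * K))\<close> of it.\<close>
  have half: "1 / 2 \<le> (\<Sum>j<K. h j s)" if "s \<in> space (x i)" for s
  proof -
    have "(\<Sum>j<K. h j s) = 1 - (\<Sum>l=1..n i. \<Sum>j<K. LINT t:cell K j|lborel. cover K (s l) t)"
      unfolding h_def sum_subtractf using i(3) by (subst sum.swap) simp
    moreover have "(\<Sum>l=1..n i. \<Sum>j<K. LINT t:cell K j|lborel. cover K (s l) t) \<le>
        (\<Sum>l=1..n i. 1 / (2 * real K))"
      using unit[OF that] i(3) by (intro sum_mono sum_integral_cell_cover_le) auto
    ultimately show ?thesis using i(2,3) by simp
  qed
  \<comment> \<open>The sign of \<open>p\<close> lets the lower bound on the losses become an upper
    bound on the payoff.\<close>
  have p: "0 \<le> p"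
    using marg[OF i(3)] by (simp add: Bochner_Integration.integral_nonneg flip: marg[OF i(3)])
  have prod: "integrable ?P (\<lambda>s. f j (s (own j)) * h j (s i))"
    "(LINT s|?P. f j (s (own j)) * h j (s i)) = p * (LINT s|x i. h j s)" if j: "j < K" for j
  proof -
    note * = integral_PiM_mult[of "{1..N}" x "own j" i "f j" "h j"]
    have ps: "k \<in> {1..N} \<Longrightarrow> prob_space (x k)" for k using x prob_space_mixed_strategy by blast
    have fj: "integrable (x (own j)) (f j)" "(LINT s|x (own j). f j s) = p"
      using int[OF j] marg[OF j] by (simp_all add: f_def[abs_def])
    show "integrable ?P (\<lambda>s. f j (s (own j)) * h j (s i))"
      using *(1) ps own[OF j] i(1) fj(1) int_h[OF j] by blast
    show "(LINT s|?P. f j (s (own j)) * h j (s i)) = p * (LINT s|x i. h j s)"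
      unfolding fj(2)[symmetric] using *(2) ps own[OF j] i(1) fj(1) int_h[OF j] by blast
  qed
  have "payoff N n i x \<le> (LINT s|?P. 1 - (\<Sum>j<K. f j (s (own j)) * h j (s i)))"
    unfolding payoff_def
  proof (rule Bochner_Integration.integral_mono)
    show "integrable ?P (pure_payoff N n i)" using x by (rule integrable_pure_payoff)
    show "integrable ?P (\<lambda>s. 1 - (\<Sum>j<K. f j (s (own j)) * h j (s i)))"
      using prod(1)
      by (intro Bochner_Integration.integrable_diff Bochner_Integration.integrable_sum finite_measure.integrable_const[OF prob_space.finite_measure[OF P]]) auto
    show "pure_payoff N n i s \<le> 1 - (\<Sum>j<K. f j (s (own j)) * h j (s i))" for s
    proof -
      have "0 < n i" using i(2,3) by simp
      from pure_payoff_le_uncovered[of i N n K own s, OF i(1) this i(3) own] show ?thesis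
        by (simp only: f_def h_def facilities_def)
    qed
  qed
  also have "\<dots> = 1 - (\<Sum>j<K. p * (LINT s|x i. h j s))"
  proof -
    have int: "integrable ?P (\<lambda>s. \<Sum>j<K. f j (s (own j)) * h j (s i))"
      using prod(1) by (intro Bochner_Integration.integrable_sum) simp
    have "(LINT s|?P. (\<Sum>j<K. f j (s (own j)) * h j (s i))) =
        (\<Sum>j<K. LINT s|?P. f j (s (own j)) * h j (s i))"
      using prod(1) by (intro Bochner_Integration.integral_sum) simp
    also have "\<dots> = (\<Sum>j<K. p * (LINT s|x i. h j s))"
      by (rule sum.cong[OF refl], rule prod(2)) simp
    finally have "(LINT s|?P. (\<Sum>j<K. f j (s (own j)) * h j (s i))) =
        (\<Sum>j<K. p * (LINT s|x i. h j s))" .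
    moreover have "(LINT s|?P. 1 - (\<Sum>j<K. f j (s (own j)) * h j (s i))) =
        (LINT s|?P. 1) - (LINT s|?P. (\<Sum>j<K. f j (s (own j)) * h j (s i)))"
      by (rule Bochner_Integration.integral_diff[OF finite_measure.integrable_const[OF prob_space.finite_measure[OF P]] int])
    moreover have "(LINT s|?P. 1 :: real) = 1"
      by (simp only: lebesgue_integral_const prob_space.prob_space[OF P] scaleR_one)
    ultimately show ?thesis by (simp only:)
  qed
  also have "(\<Sum>j<K. p * (LINT s|x i. h j s)) = p * (LINT s|x i. (\<Sum>j<K. h j s))"
    using int_h by (simp add: sum_distrib_left[symmetric])
  also have "1 - \<dots> \<le> 1 - p * (1 / 2)"
    using p half int_h by (intro diff_left_mono mult_left_mono prob_space.integral_ge_const[OF Xi]) auto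
  finally show ?thesis by simp
qed

section \<open>The equilibrium\<close>

theorem lemma11:
  fixes N :: nat and n :: "nat \<Rightarrow> nat"
  assumes "multi_unit_game N n"
    and "3 \<le> N"
    and "has_dominant_player N n"
    and "\<exists>b :: nat \<Rightarrow> nat.
           (\<forall>i\<in>{1..N - 1}. 0 < b i) \<and>
           (\<Sum>i=1..N - 1. b i) = n N \<and>
           (\<forall>i\<in>{1..N - 1}.
              real (n i) / real (b i) = (real (\<Sum>j=1..N. n j) - real (n N)) / real (n N))"
  shows "\<exists>x :: nat \<Rightarrow> (nat \<Rightarrow> real) measure. mixed_Nash_equilibrium N n x"
proof -
  obtain b where b_pos: "\<And>i. i \<in> {1..N - 1} \<Longrightarrow> 0 < b i"
    and b_sum: "(\<Sum>i=1..N - 1. b i) = n N"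
    and b_ratio: "\<And>i. i \<in> {1..N - 1} \<Longrightarrow>
      real (n i) / real (b i) = (real (\<Sum>j=1..N. n j) - real (n N)) / real (n N)"
    using assms(4) by blast
  have n_pos: "\<forall>i\<in>{1..N}. 0 < n i" and N: "1 \<le> N"
    using assms(1) by (auto simp: multi_unit_game_def)
  define K where "K = n N"
  define m where "m = (\<Sum>i=1..N - 1. n i)"
  define p where "p = real m / real K"
  have K: "0 < K" using n_pos N by (simp add: K_def)
  have mK: "m < K" using assms(3) by (simp add: has_dominant_player_def m_def K_def)
  have insert_N: "{1..N} = insert N {1..N - 1}" "N \<notin> {1..N - 1}" using N by auto
  have "(\<Sum>j=1..N. n j) = n N + m"
    unfolding m_def insert_N(1) using insert_N(2) by (intro sum.insert) auto
  then have ratio: "real (n i) / real (b i) = p" if "i \<in> {1..N - 1}" for i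
    using b_ratio[OF that] by (simp add: p_def K_def)
  \<comment> \<open>Dominance gives \<open>p < 1\<close>, so block \<open>i\<close> has room for the
    \<open>n i\<close> facilities.\<close>
  have n_le_b: "n i \<le> b i" if "i \<in> {1..N - 1}" for i
  proof -
    have "p \<le> 1" using mK by (simp add: p_def)
    with ratio[OF that] have "real (n i) / real (b i) \<le> 1" by (simp only:)
    then have "real (n i) \<le> real (b i)" using b_pos[OF that] by simp
    then show ?thesis by simp
  qed
  \<comment> \<open>Since the \<open>b i\<close> sum to \<open>n N\<close>, blocks of these sizes
    use up the grid exactly.\<close>
  have "card {..<K} = (\<Sum>i=1..N - 1. b i)" by (simp only: b_sum K_def card_lessThan)
  then obtain own where own: "own \<in> {..<K} \<rightarrow> {1..N - 1}"
    and card_own: "\<And>i. i \<in> {1..N - 1} \<Longrightarrow> card {j\<in>{..<K}. own j = i} = b i"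
    by (rule partition_with_cards[OF finite_lessThan finite_atLeastAtMost]) (rule that)
  define B where "B i = (if i = N then {..<K} else {j\<in>{..<K}. own j = i})" for i
  define x where "x i = grid_mix K (n i) (B i)" for i
  have B: "B i \<subseteq> {..<K}" for i by (auto simp: B_def)
  have card_B: "n i \<le> card (B i)" if "i \<in> {1..N}" for i
    using that n_le_b[of i] card_own[of i] by (auto simp: B_def K_def)
  have x: "\<forall>i\<in>{1..N}. x i \<in> mixed_strategies (n i)"
    unfolding x_def using grid_mix_in_mixed_strategies[OF B card_B] by blast
  have x_upd: "\<forall>k\<in>{1..N}. (x(i := x')) k \<in> mixed_strategies (n k)"
    if "x' \<in> mixed_strategies (n i)" for i x'
    using x that by auto
  \<comment> \<open>Stated for any profile agreeing with \<open>x\<close> at \<open>i\<close>, to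
    cover profiles in which someone else deviates.\<close>
  have on_grid: "AE s in (\<Pi>\<^sub>M j\<in>{1..N}. y j). \<forall>l\<in>{1..n i}. s i l \<in> grid_point K ` B i"
    if "\<forall>k\<in>{1..N}. y k \<in> mixed_strategies (n k)" "i \<in> {1..N}" "y i = x i" for y i
  proof (rule AE_profile_component[OF that(1,2)])
    show "AE s in y i. \<forall>l\<in>{1..n i}. s l \<in> grid_point K ` B i"
      unfolding that(3) x_def using B by (rule AE_grid_mix)
  qed
  \<comment> \<open>\<open>K\<close> distinct points chosen among \<open>K\<close> grid points are
    all of them.\<close>
  have dominant_grid: "facilities n s N = grid K"
    if s: "s N \<in> pure_strategies (n N)" "\<forall>l\<in>{1..n N}. s N l \<in> grid_point K ` B N" for s
  proof -
    obtain A where A: "A \<subseteq> {..<K}" "card A = K" "s N ` {1..n N} = grid_point K ` A"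
      using pure_strategy_on_grid[OF s K] by (auto simp: B_def K_def)
    then have "A = {..<K}" by (intro card_subset_eq) auto
    then show ?thesis using A by (simp only: facilities_def grid_def)
  qed
  have upper: "pure_payoff N n i s \<le> real (n i) / (2 * real K)"
    if "i \<in> {1..N - 1}" "\<forall>i\<in>{1..N}. s i \<in> pure_strategies (n i)"
      "\<forall>l\<in>{1..n N}. s N l \<in> grid_point K ` B N" for i s
  proof (rule pure_payoff_le_against_grid)
    show i: "i \<in> {1..N}" and NN: "N \<in> {1..N}" and "N \<noteq> i" using that(1) N by auto
    show "0 < n i" using n_pos i by blast
    show "facilities n s N = grid K"
      using bspec[OF that(2) NN] that(3) by (rule dominant_grid)
    show "s i ` {1..n i} \<subseteq> {0..1}"
      using pure_strategy_in_unit[OF bspec[OF that(2) i]] by blast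
  qed (rule K)
  have weak_dev: "payoff N n i (x(i := x')) \<le> real (n i) / (2 * real K)"
    if i: "i \<in> {1..N - 1}" and x': "x' \<in> mixed_strategies (n i)" for i x'
  proof -
    define y where "y = x(i := x')"
    have y: "\<forall>k\<in>{1..N}. y k \<in> mixed_strategies (n k)"
      unfolding y_def by (rule x_upd[OF x'])
    have "N \<in> {1..N}" "y N = x N" using i N by (auto simp: y_def)
    note dominant = on_grid[OF y this]
    \<comment> \<open>A deviation by \<open>i\<close> leaves the dominant player on the whole grid
      almost surely.\<close>
    have "AE s in (\<Pi>\<^sub>M j\<in>{1..N}. y j). pure_payoff N n i s \<le> real (n i) / (2 * real K)"
      using AE_profile_pure[OF y] dominant by eventually_elim (rule upper[OF i])
    then show ?thesis
      unfolding payoff_def y_def[symmetric]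
      by (intro prob_space.integral_le_const[OF prob_space_profile[OF y]] integrable_pure_payoff y)
  qed
  have all_on_grid: "AE s in (\<Pi>\<^sub>M j\<in>{1..N}. x j).
      \<forall>i\<in>{1..N}. \<forall>l\<in>{1..n i}. s i l \<in> grid_point K ` B i"
  proof (rule AE_finite_allI)
    fix i assume i: "i \<in> {1..N}"
    show "AE s in (\<Pi>\<^sub>M j\<in>{1..N}. x j). \<forall>l\<in>{1..n i}. s i l \<in> grid_point K ` B i"
      using x i refl by (rule on_grid)
  qed simp
  have weak_ge: "real (n i) / (2 * real K) \<le> payoff N n i x" if i: "i \<in> {1..N - 1}" for i
  proof -
    have iN: "i \<in> {1..N}" "i \<noteq> N" using i by auto
    have "AE s in (\<Pi>\<^sub>M j\<in>{1..N}. x j). real (n i) / (2 * real K) \<le> pure_payoff N n i s"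
      using AE_profile_pure[OF x] all_on_grid
    proof eventually_elim
      case (elim s)
      have sub: "facilities n s k \<subseteq> grid_point K ` B k" if "k \<in> {1..N}" for k
        unfolding facilities_def using bspec[OF elim(2) that] by blast
      obtain A where A: "A \<subseteq> B i" "card A = n i" "s i ` {1..n i} = grid_point K ` A"
        by (rule pure_strategy_on_grid[OF bspec[OF elim(1) iN(1)] bspec[OF elim(2) iN(1)] K])
      have "real (card A) / (2 * real K) \<le> pure_payoff N n i s"
      proof (rule pure_payoff_ge_on_grid[OF n_pos iN K])
        show "A \<subseteq> {..<K}" using A(1) B by blast
        show "facilities n s i = grid_point K ` A" using A(3) by (simp only: facilities_def)
        show "facilities n s k \<subseteq> grid K" if "k \<in> {1..N}" for k
          using sub[OF that] B[of k] by (auto simp: grid_def)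
        show "facilities n s k \<inter> facilities n s i = {}" if "k \<in> {1..N}" "k \<noteq> i" "k \<noteq> N" for k
        proof -
          \<comment> \<open>Blocks of distinct weak players are fibres of \<open>own\<close>, so two
            weak players never share a grid point.\<close>
          have "B k \<inter> B i = {}" using that iN by (auto simp: B_def)
          then have disj: "grid_point K ` B k \<inter> grid_point K ` B i = {}"
            using inj_grid_point[OF K] by (auto dest: injD)
          show ?thesis
            using Int_mono[OF sub[OF that(1)] sub[OF iN(1)]] unfolding disj by (rule subset_empty[THEN iffD1])
        qed
      qed
      then show ?case by (simp only: A(2))
    qed
    then show ?thesis
      unfolding payoff_def
      by (intro prob_space.integral_ge_const[OF prob_space_profile[OF x]] integrable_pure_payoff x)
  qed
  \<comment> \<open>By constant sum: the weak players together earn at most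
    \<open>m / (2 * K) = p / 2\<close>.\<close>
  have dominant_ge: "1 - p / 2 \<le> payoff N n N x"
  proof -
    have "AE s in (\<Pi>\<^sub>M j\<in>{1..N}. x j). 1 - p / 2 \<le> pure_payoff N n N s"
      using AE_profile_pure[OF x] all_on_grid
    proof eventually_elim
      case (elim s)
      have "(\<Sum>i=1..N - 1. pure_payoff N n i s) \<le> (\<Sum>i=1..N - 1. real (n i) / (2 * real K))"
      proof (rule sum_mono)
        fix i assume "i \<in> {1..N - 1}"
        moreover have "N \<in> {1..N}" using N by simp
        ultimately show "pure_payoff N n i s \<le> real (n i) / (2 * real K)"
          using upper[of i s] elim by blast
      qed
      also have "\<dots> = p / 2" by (simp add: p_def m_def sum_divide_distrib[symmetric])
      finally have "(\<Sum>i=1..N - 1. pure_payoff N n i s) \<le> p / 2" .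
      moreover have "pure_payoff N n N s + (\<Sum>i=1..N - 1. pure_payoff N n i s) = 1"
        using sum_pure_payoff[OF n_pos N, of s] insert_N by (simp only: insert_N(1)) simp
      ultimately show ?case by simp
    qed
    then show ?thesis
      unfolding payoff_def
      by (intro prob_space.integral_ge_const[OF prob_space_profile[OF x]] integrable_pure_payoff x)
  qed
  have dominant_dev: "payoff N n N (x(N := x')) \<le> 1 - p / 2" if x': "x' \<in> mixed_strategies (n N)" for x'
  \<comment> \<open>The weak players keep their strategies. Point \<open>j\<close> lies in the block
    of \<open>own j\<close>, who occupies it with probability
    \<open>n (own j) / b (own j) = p\<close>.\<close>
  proof (rule payoff_le_against_marginals[where K = K and own = own])
    show "\<forall>k\<in>{1..N}. (x(N := x')) k \<in> mixed_strategies (n k)"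
      by (rule x_upd[OF x'])
    show "N \<in> {1..N}" "n N = K" "0 < K" using N K by (auto simp: K_def)
    fix j assume j: "j < K"
    then have oj: "own j \<in> {1..N - 1}" using own by auto
    then show "own j \<in> {1..N} \<and> own j \<noteq> N" by auto
    then have y: "(x(N := x')) (own j) = grid_mix K (n (own j)) (B (own j))"
      and k: "n (own j) \<le> card (B (own j))" "0 < n (own j)"
      using card_B n_pos by (auto simp: x_def)
    have jB: "j \<in> B (own j)" using j by (simp add: B_def)
    note marg = grid_mix_marginal[OF B k(1) jB k(2)]
    show "integrable ((x(N := x')) (own j)) (\<lambda>s. of_bool (grid_point K j \<in> s ` {1..n (own j)}) :: real)"
      unfolding y by (rule marg(1))
    have "card (B (own j)) = b (own j)"
      using card_own[OF oj] oj insert_N(2) by (auto simp: B_def)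
    then show "(LINT s|(x(N := x')) (own j). of_bool (grid_point K j \<in> s ` {1..n (own j)})) = p"
      unfolding y marg(2) using ratio[OF oj] by simp
  qed
  have "payoff N n i (x(i := x')) \<le> payoff N n i x"
    if "i \<in> {1..N}" "x' \<in> mixed_strategies (n i)" for i x'
  proof (cases "i = N")
    case True
    then show ?thesis using order_trans[OF dominant_dev dominant_ge] that by simp
  next
    case False
    then have "i \<in> {1..N - 1}" using that(1) by auto
    from order_trans[OF weak_dev[OF this that(2)] weak_ge[OF this]] show ?thesis .
  qed
  then have "mixed_Nash_equilibrium N n x"
    using x by (auto simp: mixed_Nash_equilibrium_def)
  then show ?thesis by blast
qed

end
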